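(* Let $\Omega=\{(\epsilon,\tilde q):0<\epsilon\le1,\ \tfrac34<\tilde q<1\}$ and $\hat\epsilon=\frac23\big(3\sqrt6-2\sqrt{16-6\sqrt6}-4\big)\approx0.7103$. The parameter range $\Omega$ decomposes into two open subsets $\Omega_{node}$ and $\Omega_{focus}$ and two separatrices $Q_1$ and $Q_2$ such that the equilibrium $\psi_+(\tilde q)$ of the system $B^\#(\psi,\epsilon)\psi'=F(\psi,\tilde q)$ is a node if and only if $(\epsilon,\tilde q)\in\Omega_{node}$, and is a stable focus if and only if $(\epsilon,\tilde q)\in\Omega_{focus}$. The separatrices $Q_1$ and $Q_2$ are the graphs of two functions $$\tilde q_1:(0,1]\to(\tfrac34,1),\qquad \tilde q_2:(0,\hat\epsilon)\to(\tfrac34,1).$$ $\Omega_{focus}$ is the open subset contained between the two curves, i.e. $$\Omega_{focus}=\{(\epsilon,\tilde q)\in\Omega:\tilde q_1(\epsilon)<\tilde q,\text{ and }\tilde q<\tilde q_2(\epsilon)\text{ if }\epsilon<\hat\epsilon\},$$ and $\Omega_{node}=\Omega_{node}^1\cup\Omega_{node}^2$ consists of the two open sets $\Omega_{node}^1=\{(\epsilon,\tilde q)\in\Omega:\tilde q<\tilde q_1(\epsilon)\}$ below $Q_1$ and $\Omega_{node}^2=\{(\epsilon,\tilde q)\in\Omega:\epsilon<\hat\epsilon,\ \tilde q>\tilde q_2(\epsilon)\}$ above $Q_2$. Furthermore $$\tilde q_1(1)=\tfrac{49}{64},\qquad \lim_{\epsilon\to\hat\epsilon}\tilde q_2(\epsilon)=1,\qquad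 \lim_{\epsilon\to0}\tilde q_1(\epsilon)=\lim_{\epsilon\to0}\tilde q_2(\epsilon)=\tfrac34 .$$
   Context: State space $\Psi=\{\psi=(\psi^0,\psi^1)\in\mathbb R^2:\psi^0>|\psi^1|\}$. For $\psi\in\Psi$ put $\theta=((\psi^0)^2-(\psi^1)^2)^{-1/2}$ and $(u,v)=\theta(\psi^0,\psi^1)$, so $u^2=1+v^2$. For $\frac34<\tilde q<1$ set $q^1=1$, $q^0=\tilde q^{-1/2}$ and $$F(\psi,\tilde q)=\begin{pmatrix}-\frac43\theta^4vu+q^0\\ \theta^4(\frac43v^2+\frac13)-q^1\end{pmatrix}.$$ For $0<\epsilon\le1$ set $B^\#(\psi,\epsilon)=\epsilon B_{visc}(\psi)-B_1(\psi)-\frac{9\epsilon}{4-\epsilon}B_2(\psi)$ with $$B_{visc}=\begin{pmatrix}u^2v^2&-u^3v\\ -u^3v&u^4\end{pmatrix},\quad B_1=\begin{pmatrix}16u^2v^2&-4uv(4v^2+1)\\ -4uv(4v^2+1)&(4v^2+1)^2\end{pmatrix},$$ $$B_2=\begin{pmatrix}(u^2+v^2)^2&-2(u^2+v^2)uv\\ -2(u^2+v^2)uv&4u^2v^2\end{pmatrix}.$$ The dynamical system considered is $B^\#(\psi,\epsilon)\psi'=F(\psi,\tilde q)$. Its rest points are $\psi_-(\tilde q),\psi_+(\tilde q)$ given by $$\psi_\pm(\tilde q)=\Big(\tfrac43v^2+\tfrac13\Big)^{1/4}\begin{pmatrix}(1+v^2)^{1/2}\\ v\end{pmatrix}\Big|_{v=v_\pm(\tilde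 q)},\qquad v_\pm(\tilde q)>0,\quad v_\pm^2(\tilde q)=\frac{(2\tilde q-1)\mp\sqrt{\tilde q(4\tilde q-3)}}{4(1-\tilde q)}.$$ For every $(\epsilon,\tilde q)\in\Omega$ the rest point $\psi_+(\tilde q)$ is an attractor. It is called a stable focus or a (stable) node depending on whether the eigenvalues of the linearization of the system at $\psi_+(\tilde q)$, i.e. of $B^\#(\psi_+(\tilde q),\epsilon)^{-1}D_\psi F(\psi_+(\tilde q),\tilde q)$, have a nonzero imaginary part or not. "Open" means open relative to $\Omega$.
   Formalization: On Q_1 and Q_2 the eigenvalue is real and double, so ψ_+ is literally a node there though not in Ω_node; "node iff in Ω_node" is therefore proved off Q_1∪Q_2, and on all of Ω for nodes with two distinct eigenvalues. *)

theory Defs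
  imports "HOL-Analysis.Analysis"
begin

definition Psi :: "(real^2) set" where
  "Psi = {\<psi>. \<psi> $ 1 > \<bar>\<psi> $ 2\<bar>}"

text \<open>The coordinates \<open>\<psi>\<^sup>0, \<psi>\<^sup>1\<close> are the components \<open>\<psi> $ 1, \<psi> $ 2\<close>. The functions below
  are total; their values are meaningful on \<^const>\<open>Psi\<close>.\<close>

definition theta :: "real^2 \<Rightarrow> real" where
  "theta \<psi> = ((\<psi> $ 1)\<^sup>2 - (\<psi> $ 2)\<^sup>2) powr (-1/2)"

definition vel_u :: "real^2 \<Rightarrow> real" where
  "vel_u \<psi> = theta \<psi> * \<psi> $ 1"

definition vel_v :: "real^2 \<Rightarrow> real" where
  "vel_v \<psi> = theta \<psi> * \<psi> $ 2"

definition F :: "real^2 \<Rightarrow> real \<Rightarrow> real^2" where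
  "F \<psi> q = (let \<theta> = theta \<psi>; u = vel_u \<psi>; v = vel_v \<psi> in
     vector [- 4/3 * \<theta>^4 * v * u + q powr (-1/2),
             \<theta>^4 * (4/3 * v\<^sup>2 + 1/3) - 1])"

definition B_visc :: "real^2 \<Rightarrow> real^2^2" where
  "B_visc \<psi> = (let u = vel_u \<psi>; v = vel_v \<psi> in
     vector [vector [u\<^sup>2 * v\<^sup>2, - (u^3 * v)],
             vector [- (u^3 * v), u^4]])"

definition B_1 :: "real^2 \<Rightarrow> real^2^2" where
  "B_1 \<psi> = (let u = vel_u \<psi>; v = vel_v \<psi> in
     vector [vector [16 * u\<^sup>2 * v\<^sup>2, - (4 * u * v * (4 * v\<^sup>2 + 1))],
             vector [- (4 * u * v * (4 * v\<^sup>2 + 1)), (4 * v\<^sup>2 + 1)\<^sup>2]])"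

definition B_2 :: "real^2 \<Rightarrow> real^2^2" where
  "B_2 \<psi> = (let u = vel_u \<psi>; v = vel_v \<psi> in
     vector [vector [(u\<^sup>2 + v\<^sup>2)\<^sup>2, - (2 * (u\<^sup>2 + v\<^sup>2) * u * v)],
             vector [- (2 * (u\<^sup>2 + v\<^sup>2) * u * v), 4 * u\<^sup>2 * v\<^sup>2]])"

definition B_sharp :: "real^2 \<Rightarrow> real \<Rightarrow> real^2^2" where
  "B_sharp \<psi> \<epsilon> = \<epsilon> *\<^sub>R B_visc \<psi> - B_1 \<psi> - (9 * \<epsilon> / (4 - \<epsilon>)) *\<^sub>R B_2 \<psi>"

definition v_plus :: "real \<Rightarrow> real" where
  "v_plus q = sqrt (((2 * q - 1) - sqrt (q * (4 * q - 3))) / (4 * (1 - q)))"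

definition psi_plus :: "real \<Rightarrow> real^2" where
  "psi_plus q = (let v = v_plus q in
     (4/3 * v\<^sup>2 + 1/3) powr (1/4) *\<^sub>R vector [sqrt (1 + v\<^sup>2), v])"

definition linearization :: "real \<Rightarrow> real \<Rightarrow> real^2^2" where
  "linearization \<epsilon> q =
     matrix_inv (B_sharp (psi_plus q) \<epsilon>) ** jacobian (\<lambda>\<psi>. F \<psi> q) (at (psi_plus q))"

definition eigenvalues :: "real^'n^'n \<Rightarrow> complex set" where
  "eigenvalues A = {\<mu>. \<exists>w. w \<noteq> 0 \<and> map_matrix complex_of_real A *v w = \<mu> *s w}"

definition attractor :: "real \<Rightarrow> real \<Rightarrow> bool" where
  "attractor \<epsilon> q \<longleftrightarrow> (\<forall>\<mu> \<in> eigenvalues (linearization \<epsilon> q). Re \<mu> < 0)"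

definition stable_focus :: "real \<Rightarrow> real \<Rightarrow> bool" where
  "stable_focus \<epsilon> q \<longleftrightarrow>
     attractor \<epsilon> q \<and> (\<exists>\<mu> \<in> eigenvalues (linearization \<epsilon> q). Im \<mu> \<noteq> 0)"

definition stable_node :: "real \<Rightarrow> real \<Rightarrow> bool" where
  "stable_node \<epsilon> q \<longleftrightarrow>
     attractor \<epsilon> q \<and> \<not> (\<exists>\<mu> \<in> eigenvalues (linearization \<epsilon> q). Im \<mu> \<noteq> 0)"

text \<open>A double real eigenvalue is the borderline between node and focus. It is a
  \<^const>\<open>stable_node\<close>, but not a nondegenerate one.\<close>

definition nondegenerate_node :: "real \<Rightarrow> real \<Rightarrow> bool" where
  "nondegenerate_node \<epsilon> q \<longleftrightarrow>
     stable_node \<epsilon> q \<and> card (eigenvalues (linearization \<epsilon> q)) = 2"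

definition Omega :: "(real \<times> real) set" where
  "Omega = {0<..1} \<times> {3/4<..<1}"

definition eps_hat :: real where
  "eps_hat = 2/3 * (3 * sqrt 6 - 2 * sqrt (16 - 6 * sqrt 6) - 4)"

definition graph_on :: "'a set \<Rightarrow> ('a \<Rightarrow> 'b) \<Rightarrow> ('a \<times> 'b) set" where
  "graph_on S f = {(x, f x) | x. x \<in> S}"

lemma powr_quarter_power2: assumes "0 < (X::real)" shows "(X powr (1/4))\<^sup>2 = sqrt X"
  using assms by (simp add: powr_half_sqrt[symmetric] powr_powr flip: powr_numeral)

lemma psi_plus_rest_point: assumes q: "3/4 < q" "q < 1"
  shows "0 < v_plus q \<and> psi_plus q \<in> Psi \<and> F (psi_plus q) q = 0"
proof -
  define R where "R = sqrt (q*(4*q-3))"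
  have R2: "R^2 = q*(4*q-3)" using q by (simp add: R_def)
  have R0: "R > 0" using q by (simp add: R_def)
  define s where "s = ((2*q-1) - R)/(4*(1-q))"
  have "R^2 < (2*q-1)^2" unfolding R2 using q by (simp add: power2_eq_square algebra_simps)
  then have "R < 2*q-1" using q by (intro power2_less_imp_less[of R]) auto
  then have s0: "s > 0" using q by (simp add: s_def)
  have vs: "v_plus q = sqrt s" by (simp add: v_plus_def s_def R_def)
  have v2: "(v_plus q)^2 = s" and v0: "v_plus q > 0" using s0 by (auto simp: vs)
  have e1: "4*(1-q) * s = 2*q-1-R" using q by (simp add: s_def)
  have "(2*q-1 - 4*(1-q) * s)^2 = q*(4*q-3)" using e1 R2 by simp
  then have "(1-q) * (16*(1-q) * s^2 + (8-16*q) * s + 1) = 0" by (simp add: power2_eq_square algebra_simps)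
  then have "16*(1-q) * s^2 + (8-16*q) * s + 1 = 0" using q by auto
  then have e2: "16*q*(s*(1+s)) = (4 * s+1)^2" by (simp add: power2_eq_square algebra_simps)
  define r where "r = (4/3 * s+1/3) powr (1/4)"
  have r0: "r > 0" using s0 by (simp add: r_def)
  have r2: "r^2 = sqrt (4/3 * s+1/3)" unfolding r_def using s0 by (intro powr_quarter_power2) auto
  have r4: "r^4 = 4/3 * s+1/3" using s0 arg_cong[OF r2, of "\<lambda>x. x^2"] by simp
  have p: "psi_plus q $ 1 = r * sqrt (1+s)" "psi_plus q $ 2 = r * v_plus q"
    by (simp_all add: psi_plus_def Let_def v2 r_def)
  have "v_plus q < sqrt (1+s)" unfolding vs by simp
  then have P: "psi_plus q \<in> Psi" using v0 r0 by (simp add: Psi_def p)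
  have "(r * sqrt (1+s))\<^sup>2 - (r* v_plus q)\<^sup>2 = r^2" using s0 by (simp add: power_mult_distrib v2 algebra_simps)
  then have th: "theta (psi_plus q) = 1/r" using r0
    by (simp add: theta_def p powr_minus powr_half_sqrt field_simps)
  have uv: "vel_u (psi_plus q) = sqrt (1+s)" "vel_v (psi_plus q) = v_plus q" using r0 by (simp_all add: vel_u_def vel_v_def th p)
  have "4 * sqrt q * (v_plus q * sqrt (1+s)) = sqrt (16*q*(s*(1+s)))"
    by (simp add: vs real_sqrt_mult)
  also have "\<dots> = 4 * s+1" unfolding e2 using s0 by simp
  finally have k: "4 * sqrt q * (v_plus q * sqrt (1+s)) = 4 * s+1" .
  have "q powr (-1/2) = 1/sqrt q" using q by (simp add: powr_minus powr_half_sqrt field_simps)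
  then have "q powr (-1/2) * (4 * s + 1) = 4 * (v_plus q * sqrt (1 + s))"
    using q by (simp flip: k)
  then have c1: "- 4/3 * (1 / r)^4 * v_plus q * sqrt (1 + s) + q powr (-1/2) = 0"
    unfolding power_divide r4 using s0 by (simp add: field_simps)
  have c2: "(1 / r)^4 * (4/3 * s + 1/3) - 1 = 0"
    unfolding r4[symmetric] using r0 by (simp add: power_divide)
  have "F (psi_plus q) q = 0"
    unfolding F_def Let_def th uv v2 c1 c2 by (simp add: vec_eq_iff forall_2)
  then show ?thesis using v0 P by simp
qed

end

theory Submission
  imports Defs
begin

text \<open>
  Write \<open>s = v\<^sub>+\<^sup>2\<close>, which decreases from \<open>1/2\<close> to \<open>1/8\<close> as \<open>q\<close> runs through \<open>(3/4, 1)\<close>.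
  The eigenvalues \<open>\<mu>\<close> of the linearization are the roots of \<open>det (DF - \<mu> B\<^sup>#)\<close>, a quadratic in \<open>\<mu>\<close>
  whose coefficients all have the same strict sign; hence \<open>\<psi>\<^sub>+\<close> is an attractor, and its type is
  decided by the sign of the discriminant. Up to a positive factor this is a cubic \<open>g\<close> in \<open>s\<close>.
  Since \<open>g(s)/s\<close> is convex on \<open>s > 0\<close>, \<open>g(1/2) > 0\<close>, and \<open>g\<close> is negative at the explicit point
  \<open>(4 - \<epsilon>) / (2(4 + 5\<epsilon>))\<close>, there is exactly one zero between that point and \<open>1/2\<close>, and at most
  one between \<open>1/8\<close> and that point, which is present iff \<open>g(1/8) > 0\<close>, that is, iff \<open>\<epsilon>\<close> is less
  than \<open>eps_hat\<close>. The two zeros, expressed in terms of \<open>q\<close>, are the separatrices.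
\<close>

section \<open>Eigenvalues of real two by two matrices\<close>

lemma eigenvalues_2:
  fixes A :: "real^2^2"
  shows "eigenvalues A = {\<mu>. \<mu>\<^sup>2 - complex_of_real (A$1$1 + A$2$2) * \<mu> + complex_of_real (det A) = 0}"
proof -
  have "\<mu> \<in> eigenvalues A \<longleftrightarrow> (\<mu> - A$1$1) * (\<mu> - A$2$2) = complex_of_real (A$1$2) * A$2$1" for \<mu>
  proof -
    define a b c d where "a = complex_of_real (A$1$1)" and "b = complex_of_real (A$1$2)"
      and "c = complex_of_real (A$2$1)" and "d = complex_of_real (A$2$2)"
    note defs = this
    have eig: "\<mu> \<in> eigenvalues A \<longleftrightarrow>
        (\<exists>x y. (x \<noteq> 0 \<or> y \<noteq> 0) \<and> a * x + b * y = \<mu> * x \<and> c * x + d * y = \<mu> * y)" (is "_ \<longleftrightarrow> ?R")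
    proof
      assume "\<mu> \<in> eigenvalues A"
      then obtain w where "w \<noteq> 0" "map_matrix complex_of_real A *v w = \<mu> *s w"
        by (auto simp: eigenvalues_def)
      then show ?R
        by (intro exI[of _ "w$1"] exI[of _ "w$2"])
          (auto simp: vec_eq_iff forall_2 defs matrix_vector_mult_def sum_2 map_matrix_def)
    next
      assume ?R
      then obtain x y where "x \<noteq> 0 \<or> y \<noteq> 0" "a * x + b * y = \<mu> * x" "c * x + d * y = \<mu> * y"
        by blast
      then show "\<mu> \<in> eigenvalues A"
        unfolding eigenvalues_def mem_Collect_eq
        by (intro exI[of _ "vector [x, y]"])
          (auto simp: vec_eq_iff forall_2 defs matrix_vector_mult_def sum_2 map_matrix_def)
    qed
    have "?R \<longleftrightarrow> (\<mu> - a) * (\<mu> - d) = b * c"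
    proof
      assume ?R
      then obtain x y where xy: "x \<noteq> 0 \<or> y \<noteq> 0"
        "a * x + b * y = \<mu> * x" "c * x + d * y = \<mu> * y"
        by blast
      have "((\<mu> - a) * (\<mu> - d) - b * c) * x = 0" "((\<mu> - a) * (\<mu> - d) - b * c) * y = 0"
        using xy(2,3) by algebra+
      then show "(\<mu> - a) * (\<mu> - d) = b * c" using xy(1) by auto
    next
      assume char: "(\<mu> - a) * (\<mu> - d) = b * c"
      \<comment> \<open>The vector \<open>(b, \<mu> - a)\<close> solves the first row identically
        and the second by \<open>char\<close>. If it vanishes, \<open>(\<mu> - d, c)\<close> serves;
        if both vanish, the matrix is \<mu> times the identity.\<close>
      show ?R
      proof (cases "b = 0 \<and> \<mu> = a")
        case False
        then show ?thesis using char
          by (intro exI[of _ b] exI[of _ "\<mu> - a"]) (auto simp: algebra_simps)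
      next
        case ba: True
        show ?thesis
        proof (cases "c = 0 \<and> \<mu> = d")
          case False
          then show ?thesis using ba
            by (intro exI[of _ "\<mu> - d"] exI[of _ c]) (auto simp: algebra_simps)
        next
          case True
          then show ?thesis using ba by (intro exI[of _ 1] exI[of _ 0]) auto
        qed
      qed
    qed
    then show ?thesis using eig by (simp add: defs)
  qed
  then show ?thesis
    by (auto simp: det_2 algebra_simps power2_eq_square)
qed

text \<open>Multiplying the characteristic polynomial by \<open>det B\<close> turns the trace into
  that of the adjugate of \<open>B\<close> times \<open>M\<close>, and the determinant into
  \<open>det M\<close>; no inverse has to be computed.\<close>

lemma eigenvalues_matrix_inv_mult:
  fixes B M :: "real^2^2"
  assumes "det B \<noteq> 0"
  shows "eigenvalues (matrix_inv B ** M) =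
    {\<mu>. complex_of_real (det B) * \<mu>\<^sup>2
        - complex_of_real (B$2$2 * M$1$1 - B$1$2 * M$2$1 + B$1$1 * M$2$2 - B$2$1 * M$1$2) * \<mu>
        + complex_of_real (det M) = 0}"
proof -
  define A where "A = matrix_inv B ** M"
  obtain C where "B ** C = mat 1 \<and> C ** B = mat 1"
    using assms unfolding invertible_det_nz[symmetric] invertible_def by blast
  then have "B ** matrix_inv B = mat 1"
    unfolding matrix_inv_def by (metis (mono_tags, lifting) someI)
  then have "B ** A = M" by (simp add: A_def matrix_mul_assoc)
  then have M: "M$i$j = B$i$1 * A$1$j + B$i$2 * A$2$j" for i j
    by (auto simp: matrix_matrix_mult_def sum_2)
  have t: "B$2$2 * M$1$1 - B$1$2 * M$2$1 + B$1$1 * M$2$2 - B$2$1 * M$1$2 = det B * (A$1$1 + A$2$2)"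
    and d: "det M = det B * det A"
    unfolding det_2 M by (simp_all add: algebra_simps)
  have *: "complex_of_real (det B) * \<mu>\<^sup>2 - complex_of_real (det B * (A$1$1 + A$2$2)) * \<mu>
        + complex_of_real (det B * det A)
     = complex_of_real (det B) * (\<mu>\<^sup>2 - complex_of_real (A$1$1 + A$2$2) * \<mu> + complex_of_real (det A))" for \<mu>
    by (simp add: algebra_simps)
  show ?thesis
    unfolding A_def[symmetric] t d eigenvalues_2 * using assms by auto
qed

text \<open>Completing the square: \<open>4 * a\<close> times the quadratic is
  \<open>(2 * a * \<mu> + b)\<^sup>2\<close> minus the discriminant, which therefore decides number
  and type of the roots.\<close>

lemma real_quadratic_complex_roots:
  fixes a b c :: real
  assumes "a > 0" "b > 0" "c > 0"
  defines "E \<equiv> {\<mu>::complex. of_real a * \<mu>\<^sup>2 + of_real b * \<mu> + of_real c = 0}"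
  shows "\<forall>\<mu>\<in>E. Re \<mu> < 0"
    and "(\<exists>\<mu>\<in>E. Im \<mu> \<noteq> 0) \<longleftrightarrow> b\<^sup>2 - 4 * a * c < 0"
    and "b\<^sup>2 - 4 * a * c \<ge> 0 \<Longrightarrow> card E = 2 \<longleftrightarrow> b\<^sup>2 - 4 * a * c > 0"
proof -
  have mem: "\<mu> \<in> E \<longleftrightarrow> (2 * of_real a * \<mu> + of_real b)\<^sup>2 = of_real (b\<^sup>2 - 4 * a * c)" for \<mu>
  proof -
    have "(2 * of_real a * \<mu> + of_real b)\<^sup>2 - of_real (b\<^sup>2 - 4 * a * c)
        = 4 * of_real a * (of_real a * \<mu>\<^sup>2 + of_real b * \<mu> + of_real c)"
      by (simp add: algebra_simps power2_eq_square)
    then show ?thesis using \<open>a > 0\<close> unfolding E_def by auto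
  qed
  show "\<forall>\<mu>\<in>E. Re \<mu> < 0"
  proof
    fix \<mu> assume "\<mu> \<in> E"
    then have "Re (of_real a * \<mu>\<^sup>2 + of_real b * \<mu> + of_real c) = 0"
      "Im (of_real a * \<mu>\<^sup>2 + of_real b * \<mu> + of_real c) = 0"
      unfolding E_def by simp_all
    then have re: "a * ((Re \<mu>)\<^sup>2 - (Im \<mu>)\<^sup>2) + b * Re \<mu> + c = 0"
      and im: "Im \<mu> * (2 * a * Re \<mu> + b) = 0"
      by (simp_all add: power2_eq_square algebra_simps)
    show "Re \<mu> < 0"
    \<comment> \<open>If \<open>Re \<mu> \<ge> 0\<close>, the imaginary part of the equation forces
      \<mu> to be real, and then no term is negative while \<open>c > 0\<close>.\<close>
    proof (rule ccontr)
      assume "\<not> Re \<mu> < 0"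
      then have r: "Re \<mu> \<ge> 0" by simp
      then have "2 * a * Re \<mu> + b > 0" using assms by (simp add: add_nonneg_pos)
      then have "Im \<mu> = 0" using im by simp
      then have "a * (Re \<mu>)\<^sup>2 + b * Re \<mu> + c = 0" using re by simp
      moreover have "a * (Re \<mu>)\<^sup>2 + b * Re \<mu> \<ge> 0" using r assms by simp
      ultimately show False using \<open>c > 0\<close> by simp
    qed
  qed
  show "(\<exists>\<mu>\<in>E. Im \<mu> \<noteq> 0) \<longleftrightarrow> b\<^sup>2 - 4 * a * c < 0"
  proof
    assume "\<exists>\<mu>\<in>E. Im \<mu> \<noteq> 0"
    then obtain \<mu> where m: "\<mu> \<in> E" "Im \<mu> \<noteq> 0" by blast
    have "Re ((2 * of_real a * \<mu> + of_real b)\<^sup>2) = b\<^sup>2 - 4 * a * c"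
      "Im ((2 * of_real a * \<mu> + of_real b)\<^sup>2) = 0"
      using m(1) unfolding mem by simp_all
    then have "(2 * a * Re \<mu> + b)\<^sup>2 - (2 * a * Im \<mu>)\<^sup>2 = b\<^sup>2 - 4 * a * c"
      "(2 * a * Re \<mu> + b) * (2 * a * Im \<mu>) = 0"
      by (auto simp: power2_eq_square)
    \<comment> \<open>Since \<open>Im \<mu> \<noteq> 0\<close>, the second equation makes
      \<open>2 * a * Re \<mu> + b\<close> vanish.\<close>
    then have "b\<^sup>2 - 4 * a * c = - (2 * a * Im \<mu>)\<^sup>2" using m(2) \<open>a > 0\<close> by simp
    also have "\<dots> < 0" using m(2) \<open>a > 0\<close> by simp
    finally show "b\<^sup>2 - 4 * a * c < 0" .
  next
    assume "b\<^sup>2 - 4 * a * c < 0"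
    then have "(2 * of_real a * Complex (- b / (2 * a)) (sqrt (- (b\<^sup>2 - 4 * a * c)) / (2 * a)) + of_real b)\<^sup>2
        = (\<i> * of_real (sqrt (- (b\<^sup>2 - 4 * a * c))))\<^sup>2"
      using \<open>a > 0\<close> by (intro arg_cong[where f = "\<lambda>z. z\<^sup>2"]) (simp add: complex_eq_iff)
    also have "\<dots> = of_real (b\<^sup>2 - 4 * a * c)"
      using \<open>b\<^sup>2 - 4 * a * c < 0\<close> by (simp add: power_mult_distrib flip: of_real_power)
    finally have "Complex (- b / (2 * a)) (sqrt (- (b\<^sup>2 - 4 * a * c)) / (2 * a)) \<in> E"
      unfolding mem .
    then show "\<exists>\<mu>\<in>E. Im \<mu> \<noteq> 0" using \<open>b\<^sup>2 - 4 * a * c < 0\<close> \<open>a > 0\<close>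
      by (intro bexI) auto
  qed
  show "card E = 2 \<longleftrightarrow> b\<^sup>2 - 4 * a * c > 0" if nonneg: "b\<^sup>2 - 4 * a * c \<ge> 0"
  proof -
    define r where "r = sqrt (b\<^sup>2 - 4 * a * c)"
    have r2: "complex_of_real (b\<^sup>2 - 4 * a * c) = (complex_of_real r)\<^sup>2"
      using nonneg unfolding r_def by (simp flip: of_real_power del: of_real_diff)
    have "E = {of_real ((- b + r) / (2 * a)), of_real ((- b - r) / (2 * a))}"
    proof (rule set_eqI)
      fix \<mu>
      have "\<mu> \<in> E \<longleftrightarrow> 2 * of_real a * \<mu> + of_real b = of_real r \<or> 2 * of_real a * \<mu> + of_real b = - of_real r"
        unfolding mem r2 by (rule power2_eq_iff)
      also have "2 * of_real a * \<mu> + of_real b = of_real r \<longleftrightarrow> \<mu> = of_real ((- b + r) / (2 * a))"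
        using \<open>a > 0\<close> by (auto simp: field_simps)
      also have "2 * of_real a * \<mu> + of_real b = - of_real r \<longleftrightarrow> \<mu> = of_real ((- b - r) / (2 * a))"
        using \<open>a > 0\<close> by (auto simp: field_simps) (simp_all add: algebra_simps eq_neg_iff_add_eq_0 flip: eq_diff_eq)
      finally show "\<mu> \<in> E \<longleftrightarrow> \<mu> \<in> {of_real ((- b + r) / (2 * a)), of_real ((- b - r) / (2 * a))}"
        by blast
    qed
    moreover have "(- b + r) / (2 * a) = (- b - r) / (2 * a) \<longleftrightarrow> r = 0" using \<open>a > 0\<close> by auto
    moreover have "r = 0 \<longleftrightarrow> \<not> b\<^sup>2 - 4 * a * c > 0" using nonneg by (auto simp: r_def)
    ultimately show ?thesis by (auto simp: card_insert_if simp del: of_real_divide)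
  qed
qed

section \<open>Sign of the discriminant\<close>

text \<open>Up to a positive factor, the discriminant of \<open>det (DF - \<mu> B\<^sup>#)\<close> as a quadratic in \<open>\<mu>\<close>,
  with \<open>s = v\<^sub>+\<^sup>2\<close>.\<close>

definition disc_poly :: "real \<Rightarrow> real \<Rightarrow> real" where
  "disc_poly \<epsilon> s = s * ((4 + 6 * \<epsilon> - \<epsilon>\<^sup>2) - (8 + \<epsilon>\<^sup>2) * s)\<^sup>2
     - 4 * \<epsilon> * (4 - \<epsilon>) * (1 - 2 * s) * ((8 + \<epsilon>) * s - (1 - \<epsilon>))"

text \<open>For \<open>0 < a < b < c\<close> this is the convexity inequality of \<open>disc_poly \<epsilon> s / s\<close>, cleared of
  denominators.\<close>

lemma disc_poly_three_points:
  "(c - b) * b * c * disc_poly \<epsilon> a + (b - a) * a * b * disc_poly \<epsilon> c - (c - a) * a * c * disc_poly \<epsilon> b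
   = ((8 + \<epsilon>\<^sup>2)\<^sup>2 * a * b * c + 4 * \<epsilon> * (4 - \<epsilon>) * (1 - \<epsilon>)) * ((c - b) * (b - a) * (c - a))"
  unfolding disc_poly_def by algebra

text \<open>As \<open>\<epsilon>\<close> tends to \<open>0\<close>, both zeros of \<open>disc_poly \<epsilon>\<close> near \<open>1/2\<close> equal
  \<open>1/2 - 3\<epsilon>/4 + 15\<epsilon>\<^sup>2/16\<close> up to terms of order \<open>\<epsilon> powr (5/2)\<close>, and only these terms separate
  them. The point below is chosen to share this expansion up to order \<open>\<epsilon>\<^sup>2\<close>.\<close>

definition s_mid :: "real \<Rightarrow> real" where "s_mid \<epsilon> = (4 - \<epsilon>) / (2 * (4 + 5 * \<epsilon>))"

text \<open>After clearing the denominator \<open>t\<close>, all powers of \<epsilon> below the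
  fifth cancel, by the choice of \<open>s_mid\<close>, and what remains is negative.\<close>

lemma disc_poly_s_mid:
  assumes "0 < \<epsilon>" "\<epsilon> \<le> 1"
  shows "disc_poly \<epsilon> (s_mid \<epsilon>) < 0"
proof -
  define t where "t = 4 + 5 * \<epsilon>"
  have t: "t > 0" using assms by (simp add: t_def)
  define m where "m = s_mid \<epsilon> * t"
  have m: "2 * m = 4 - \<epsilon>" using t unfolding m_def s_mid_def t_def[symmetric] by (simp add: field_simps)
  have "disc_poly \<epsilon> (s_mid \<epsilon>) * t^3 = m * ((4 + 6 * \<epsilon> - \<epsilon>\<^sup>2) * t - (8 + \<epsilon>\<^sup>2) * m)\<^sup>2
     - 4 * \<epsilon> * (4 - \<epsilon>) * (t - 2 * m) * ((8 + \<epsilon>) * m - (1 - \<epsilon>) * t) * t"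
    unfolding disc_poly_def m_def by algebra
  then have "8 * (disc_poly \<epsilon> (s_mid \<epsilon>) * t^3) = - 81 * \<epsilon>^5 * ((64 - \<epsilon>) * (4 - \<epsilon>))"
    using m unfolding t_def by algebra
  moreover have "\<epsilon>^5 * ((64 - \<epsilon>) * (4 - \<epsilon>)) > 0"
    using assms by simp
  ultimately have "disc_poly \<epsilon> (s_mid \<epsilon>) * t^3 < 0" by linarith
  then show ?thesis using t by (simp add: mult_less_0_iff)
qed

lemma s_mid_bounds:
  assumes "0 < \<epsilon>" "\<epsilon> \<le> 1"
  shows "1/8 < s_mid \<epsilon>" "s_mid \<epsilon> < 1/2"
  using assms by (simp_all add: s_mid_def field_simps)

lemma disc_poly_half_pos:
  assumes "0 < \<epsilon>" "\<epsilon> \<le> 1"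
  shows "disc_poly \<epsilon> (1/2) > 0"
proof -
  have "disc_poly \<epsilon> (1/2) = 9/8 * (\<epsilon> * (4 - \<epsilon>))\<^sup>2"
    unfolding disc_poly_def by (simp add: power2_eq_square algebra_simps)
  moreover have "\<epsilon> * (4 - \<epsilon>) > 0" using assms by simp
  ultimately show ?thesis by (metis zero_less_power mult_pos_pos zero_less_divide_iff zero_less_numeral)
qed

lemma eps_hat_bounds: "0 < eps_hat" "eps_hat < 1"
  and disc_poly_eighth: "\<lbrakk>0 < \<epsilon>; \<epsilon> \<le> 1\<rbrakk> \<Longrightarrow> disc_poly \<epsilon> (1/8) > 0 \<longleftrightarrow> \<epsilon> < eps_hat"
proof -
  define w where "w = sqrt 6"
  have w2: "w\<^sup>2 = 6" and w_lo: "9/4 < w" and w_hi: "w < 5/2"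
    unfolding w_def
    by (simp, rule real_less_rsqrt, simp add: power2_eq_square, rule real_less_lsqrt)
      (simp_all add: power2_eq_square)
  \<comment> \<open>\<open>m\<close> and \<open>d\<close> are midpoint and half-distance of the
    roots of \<open>\<epsilon>\<^sup>2 + (16/3 - 4 * w) * \<epsilon> + 8/3\<close>. The constant
    term is \<open>m\<^sup>2 - d\<^sup>2\<close>, and the value at 1 is \<open>9 - 4 * w\<close>,
    hence the bound 9/4 on \<open>w\<close>; the bound 5/2 keeps the radicand in \<open>d\<close>
    positive.\<close>
  define m where "m = 2 * w - 8/3"
  define d where "d = 4/3 * sqrt (16 - 6 * w)"
  have d0: "d > 0" using w_hi by (simp add: d_def)
  have d2: "d\<^sup>2 = 16/9 * (16 - 6 * w)" using w_hi unfolding d_def power_mult_distrib by (simp add: power_divide)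
  have hat: "eps_hat = m - d" by (simp add: eps_hat_def m_def d_def w_def)
  have "d\<^sup>2 < m\<^sup>2" unfolding d2 m_def using w2 by (simp add: power2_eq_square algebra_simps)
  then have "d < m" using w_lo by (intro power2_less_imp_less[of d m]) (simp_all add: m_def)
  then show "0 < eps_hat" unfolding hat by simp
  have "(m - 1)\<^sup>2 < d\<^sup>2" unfolding d2 m_def using w2 w_lo by (simp add: power2_eq_square algebra_simps)
  then have "m - 1 < d" using d0 by (intro power2_less_imp_less[of "m - 1" d]) simp_all
  then show "eps_hat < 1" unfolding hat by simp
  \<comment> \<open>\<open>disc_poly \<epsilon> (1/8)\<close> is a quartic that splits over the field generated by \<open>sqrt 6\<close> into two
    conjugate quadratics; \<open>eps_hat\<close> is the smaller root of the one with \<open>- sqrt 6\<close>.\<close>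
  define c where "c \<epsilon> = \<epsilon>\<^sup>2 + (16/3 + 4 * w) * \<epsilon> + 8/3" for \<epsilon>
  have c0: "c \<epsilon> > 0" if "\<epsilon> > 0" for \<epsilon>
    using that w_lo unfolding c_def by (intro add_nonneg_pos) auto
  have fact: "disc_poly \<epsilon> (1/8) = 81/512 * c \<epsilon> * ((m + d - \<epsilon>) * (eps_hat - \<epsilon>))" for \<epsilon>
  proof -
    have "(m + d - \<epsilon>) * (eps_hat - \<epsilon>) = (m - \<epsilon>)\<^sup>2 - d\<^sup>2"
      unfolding hat by (simp add: power2_eq_square algebra_simps)
    also have "\<dots> = \<epsilon>\<^sup>2 + (16/3 - 4 * w) * \<epsilon> + 8/3"
      unfolding d2 m_def using w2 by (simp add: power2_eq_square algebra_simps)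
    finally have quad: "(m + d - \<epsilon>) * (eps_hat - \<epsilon>) = \<epsilon>\<^sup>2 + (16/3 - 4 * w) * \<epsilon> + 8/3" .
    have "c \<epsilon> * ((m + d - \<epsilon>) * (eps_hat - \<epsilon>)) = (\<epsilon>\<^sup>2 + 16/3 * \<epsilon> + 8/3)\<^sup>2 - 16 * w\<^sup>2 * \<epsilon>\<^sup>2"
      unfolding c_def quad by (simp add: power2_eq_square algebra_simps)
    also have "\<dots> = 512/81 * disc_poly \<epsilon> (1/8)"
      unfolding disc_poly_def w2 by (simp add: power2_eq_square field_simps)
    finally show ?thesis by simp
  qed
  \<comment> \<open>The other root exceeds 1, so on \<open>(0, 1]\<close> only
    \<open>eps_hat - \<epsilon>\<close> can change sign.\<close>
  have big: "m + d > 1" using w_lo d0 by (simp add: m_def)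
  show "disc_poly \<epsilon> (1/8) > 0 \<longleftrightarrow> \<epsilon> < eps_hat" if "0 < \<epsilon>" "\<epsilon> \<le> 1"
    using that big c0[of \<epsilon>] unfolding fact by (simp add: zero_less_mult_iff)
qed

text \<open>Convexity of \<open>disc_poly \<epsilon> s / s\<close>. It is strict because
  \<open>(8 + \<epsilon>\<^sup>2)\<^sup>2 * a * b * c\<close> stays positive even at
  \<open>\<epsilon> = 1\<close>, where the other summand vanishes.\<close>

lemma disc_poly_neg_between:
  assumes "0 < \<epsilon>" "\<epsilon> \<le> 1" "0 < a" "a < b" "b < c"
    and "disc_poly \<epsilon> a \<le> 0" "disc_poly \<epsilon> c \<le> 0"
  shows "disc_poly \<epsilon> b < 0"
proof -
  have "((8 + \<epsilon>\<^sup>2)\<^sup>2 * a * b * c + 4 * \<epsilon> * (4 - \<epsilon>) * (1 - \<epsilon>)) * ((c - b) * (b - a) * (c - a)) > 0"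
    using assms by (intro mult_pos_pos add_pos_nonneg mult_nonneg_nonneg zero_less_power) auto
  moreover have "(c - b) * b * c * disc_poly \<epsilon> a \<le> 0" "(b - a) * a * b * disc_poly \<epsilon> c \<le> 0"
    using assms by (intro mult_nonneg_nonpos; simp)+
  ultimately have "(c - a) * a * c * disc_poly \<epsilon> b < 0"
    using disc_poly_three_points[of c b \<epsilon> a] by linarith
  then show ?thesis using assms by (simp add: mult_less_0_iff)
qed

section \<open>Zeros of the cubic and its sign pattern\<close>

lemma continuous_on_disc_poly [continuous_intros]:
  assumes "continuous_on S f" "continuous_on S g"
  shows "continuous_on S (\<lambda>x. disc_poly (f x) (g x))"
  unfolding disc_poly_def by (intro continuous_intros assms)

text \<open>The choice in \<open>s_lower\<close> is from an empty set unless \<open>\<epsilon> < eps_hat\<close>.\<close>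

definition s_lower :: "real \<Rightarrow> real" where
  "s_lower \<epsilon> = (SOME s. 1/8 < s \<and> s < s_mid \<epsilon> \<and> disc_poly \<epsilon> s = 0)"

definition s_upper :: "real \<Rightarrow> real" where
  "s_upper \<epsilon> = (SOME s. s_mid \<epsilon> < s \<and> s < 1/2 \<and> disc_poly \<epsilon> s = 0)"

lemma s_upper:
  assumes "0 < \<epsilon>" "\<epsilon> \<le> 1"
  shows "s_mid \<epsilon> < s_upper \<epsilon>" "s_upper \<epsilon> < 1/2" "disc_poly \<epsilon> (s_upper \<epsilon>) = 0"
proof -
  have "\<exists>s\<ge>s_mid \<epsilon>. s \<le> 1/2 \<and> disc_poly \<epsilon> s = 0"
    using disc_poly_s_mid[OF assms] disc_poly_half_pos[OF assms] s_mid_bounds[OF assms]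
    by (intro IVT') (auto intro!: continuous_intros)
  then obtain s where s: "s_mid \<epsilon> \<le> s" "s \<le> 1/2" "disc_poly \<epsilon> s = 0" by blast
  \<comment> \<open>The intermediate value theorem yields a zero in the closed interval; the nonzero
    end values make its bounds strict.\<close>
  then have "s \<noteq> s_mid \<epsilon>" "s \<noteq> 1/2"
    using disc_poly_s_mid[OF assms] disc_poly_half_pos[OF assms] by (metis less_irrefl)+
  then have "\<exists>s. s_mid \<epsilon> < s \<and> s < 1/2 \<and> disc_poly \<epsilon> s = 0" using s by (intro exI[of _ s]) auto
  from someI_ex[OF this] show "s_mid \<epsilon> < s_upper \<epsilon>" "s_upper \<epsilon> < 1/2" "disc_poly \<epsilon> (s_upper \<epsilon>) = 0"
    by (auto simp: s_upper_def)
qed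

lemma s_lower:
  assumes "0 < \<epsilon>" "\<epsilon> < eps_hat"
  shows "1/8 < s_lower \<epsilon>" "s_lower \<epsilon> < s_mid \<epsilon>" "disc_poly \<epsilon> (s_lower \<epsilon>) = 0"
proof -
  have e1: "\<epsilon> \<le> 1" using assms eps_hat_bounds by simp
  note e = assms(1) e1
  have pos: "disc_poly \<epsilon> (1/8) > 0" using disc_poly_eighth[OF e] assms by simp
  have "\<exists>s\<ge>1/8. s \<le> s_mid \<epsilon> \<and> disc_poly \<epsilon> s = 0"
    using disc_poly_s_mid[OF e] pos s_mid_bounds[OF e]
    by (intro IVT2') (auto intro!: continuous_intros)
  then obtain s where s: "1/8 \<le> s" "s \<le> s_mid \<epsilon>" "disc_poly \<epsilon> s = 0" by blast
  then have "s \<noteq> s_mid \<epsilon>" "s \<noteq> 1/8"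
    using disc_poly_s_mid[OF e] pos by (metis less_irrefl)+
  then have "\<exists>s. 1/8 < s \<and> s < s_mid \<epsilon> \<and> disc_poly \<epsilon> s = 0" using s by (intro exI[of _ s]) auto
  from someI_ex[OF this] show "1/8 < s_lower \<epsilon>" "s_lower \<epsilon> < s_mid \<epsilon>" "disc_poly \<epsilon> (s_lower \<epsilon>) = 0"
    by (auto simp: s_lower_def)
qed

lemma disc_poly_sign_right:
  assumes "0 < \<epsilon>" "\<epsilon> \<le> 1" "s_mid \<epsilon> \<le> s"
  shows "disc_poly \<epsilon> s < 0 \<longleftrightarrow> s < s_upper \<epsilon>" "disc_poly \<epsilon> s > 0 \<longleftrightarrow> s_upper \<epsilon> < s"
proof -
  note u = s_upper[OF assms(1,2)] and mid = disc_poly_s_mid[OF assms(1,2)]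
  have mid0: "0 < s_mid \<epsilon>" using s_mid_bounds[OF assms(1,2)] by simp
  have "disc_poly \<epsilon> s < 0" if "s < s_upper \<epsilon>"
    using disc_poly_neg_between[OF assms(1,2) mid0, of s "s_upper \<epsilon>"] that assms(3) u mid
    by (cases "s = s_mid \<epsilon>") auto
  \<comment> \<open>A value \<open>\<le> 0\<close> at \<open>s\<close>, with the negative one at
    \<open>s_mid \<epsilon>\<close>, would force a negative value at the zero
    \<open>s_upper \<epsilon>\<close> in between.\<close>
  moreover have "disc_poly \<epsilon> s > 0" if "s_upper \<epsilon> < s"
    using disc_poly_neg_between[OF assms(1,2) mid0 u(1) that] u(3) mid by force
  ultimately show "disc_poly \<epsilon> s < 0 \<longleftrightarrow> s < s_upper \<epsilon>" "disc_poly \<epsilon> s > 0 \<longleftrightarrow> s_upper \<epsilon> < s"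
    using u(3) by (cases s "s_upper \<epsilon>" rule: linorder_cases; auto)+
qed

lemma disc_poly_sign_left:
  assumes "0 < \<epsilon>" "\<epsilon> < eps_hat" "0 < s" "s \<le> s_mid \<epsilon>"
  shows "disc_poly \<epsilon> s < 0 \<longleftrightarrow> s_lower \<epsilon> < s" "disc_poly \<epsilon> s > 0 \<longleftrightarrow> s < s_lower \<epsilon>"
proof -
  have e1: "\<epsilon> \<le> 1" using assms eps_hat_bounds by simp
  note u = s_lower[OF assms(1,2)] and mid = disc_poly_s_mid[OF assms(1) e1]
  have "disc_poly \<epsilon> s < 0" if "s_lower \<epsilon> < s"
    using disc_poly_neg_between[OF assms(1) e1, of "s_lower \<epsilon>" s "s_mid \<epsilon>"] that assms(4) u mid
    by (cases "s = s_mid \<epsilon>") auto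
  moreover have "disc_poly \<epsilon> s > 0" if "s < s_lower \<epsilon>"
    using disc_poly_neg_between[OF assms(1) e1 assms(3) that u(2)] u(3) mid by force
  ultimately show "disc_poly \<epsilon> s < 0 \<longleftrightarrow> s_lower \<epsilon> < s" "disc_poly \<epsilon> s > 0 \<longleftrightarrow> s < s_lower \<epsilon>"
    using u(3) by (cases s "s_lower \<epsilon>" rule: linorder_cases; auto)+
qed

text \<open>From \<open>eps_hat\<close> on, the cubic is nonpositive already at 1/8, and convexity
  leaves no zero between there and \<open>s_mid \<epsilon>\<close>.\<close>

lemma disc_poly_neg_left:
  assumes "eps_hat \<le> \<epsilon>" "\<epsilon> \<le> 1" "1/8 < s" "s \<le> s_mid \<epsilon>"
  shows "disc_poly \<epsilon> s < 0"
proof -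
  have e: "0 < \<epsilon>" using assms eps_hat_bounds by simp
  note mid = disc_poly_s_mid[OF e assms(2)]
  have "disc_poly \<epsilon> (1/8) \<le> 0" using disc_poly_eighth[OF e assms(2)] assms by force
  then show ?thesis
    using disc_poly_neg_between[OF e assms(2), of "1/8" s "s_mid \<epsilon>"] assms mid
    by (cases "s = s_mid \<epsilon>") auto
qed

lemma disc_poly_neg_iff:
  assumes "0 < \<epsilon>" "\<epsilon> \<le> 1" "1/8 < s"
  shows "disc_poly \<epsilon> s < 0 \<longleftrightarrow> s < s_upper \<epsilon> \<and> (\<epsilon> < eps_hat \<longrightarrow> s_lower \<epsilon> < s)"
  using disc_poly_sign_right[OF assms(1,2), of s] disc_poly_sign_left[OF assms(1), of s]
    disc_poly_neg_left[of \<epsilon> s] s_upper[OF assms(1,2)] s_lower[OF assms(1)] assms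
  by (cases "s \<le> s_mid \<epsilon>"; cases "\<epsilon> < eps_hat") auto

lemma disc_poly_pos_iff:
  assumes "0 < \<epsilon>" "\<epsilon> \<le> 1" "1/8 < s"
  shows "disc_poly \<epsilon> s > 0 \<longleftrightarrow> s_upper \<epsilon> < s \<or> (\<epsilon> < eps_hat \<and> s < s_lower \<epsilon>)"
  using disc_poly_sign_right[OF assms(1,2), of s] disc_poly_sign_left[OF assms(1), of s]
    disc_poly_neg_left[of \<epsilon> s] s_upper[OF assms(1,2)] s_lower[OF assms(1)] assms
  by (cases "s \<le> s_mid \<epsilon>"; cases "\<epsilon> < eps_hat") auto

section \<open>Special value and limits of the zeros\<close>

lemma s_upper_1: "s_upper 1 = 1/3"
proof -
  have "disc_poly 1 (s_upper 1) = 0" "s_upper 1 > 0"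
    using s_upper[of 1] s_mid_bounds[of 1] by auto
  moreover have "disc_poly 1 s = 27 * s * (3 * s - 1) * (s + 1)" for s
    unfolding disc_poly_def by (simp add: algebra_simps power2_eq_square)
  ultimately show ?thesis by simp
qed

lemma s_mid_tendsto: "(s_mid \<longlongrightarrow> 1/2) (at_right 0)"
  unfolding s_mid_def by (auto intro!: tendsto_eq_intros)

lemma eventually_eps_range: "\<forall>\<^sub>F \<epsilon> in at_right 0. 0 < \<epsilon> \<and> \<epsilon> < eps_hat"
  using eps_hat_bounds by (auto simp: eventually_at_right_field)

lemma s_upper_tendsto: "(s_upper \<longlongrightarrow> 1/2) (at_right 0)"
proof (rule tendsto_sandwich[OF _ _ s_mid_tendsto tendsto_const])
  show "\<forall>\<^sub>F \<epsilon> in at_right 0. s_mid \<epsilon> \<le> s_upper \<epsilon>" "\<forall>\<^sub>F \<epsilon> in at_right 0. s_upper \<epsilon> \<le> 1/2"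
    using eventually_eps_range
    by (eventually_elim; use s_upper eps_hat_bounds in \<open>force\<close>)+
qed

lemma disc_poly_tendsto: "((\<lambda>\<epsilon>. disc_poly \<epsilon> s) \<longlongrightarrow> disc_poly e s) (at e within S)"
  unfolding disc_poly_def by (intro tendsto_intros)

text \<open>At \<open>\<epsilon> = 0\<close> the cubic is
  \<open>16 * s * (1 - 2 * s)\<^sup>2\<close>, positive at each fixed \<open>s\<close> in
  \<open>(0, 1/2)\<close>. For small \<epsilon> it is still positive there and
  \<open>s_mid \<epsilon>\<close> has moved past \<open>s\<close>, so
  \<open>s < s_lower \<epsilon>\<close>.\<close>

lemma s_lower_tendsto_half: "(s_lower \<longlongrightarrow> 1/2) (at_right 0)"
proof (rule order_tendstoI)
  fix a :: real assume "a < 1/2"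
  define s where "s = max a (1/4)"
  have s: "0 < s" "s < 1/2" "a \<le> s" using \<open>a < 1/2\<close> by (auto simp: s_def)
  have "disc_poly 0 s > 0" using s by (simp add: disc_poly_def)
  then have "\<forall>\<^sub>F \<epsilon> in at_right 0. disc_poly \<epsilon> s > 0"
    by (rule order_tendstoD(1)[OF disc_poly_tendsto])
  moreover have "\<forall>\<^sub>F \<epsilon> in at_right 0. s < s_mid \<epsilon>"
    using order_tendstoD(1)[OF s_mid_tendsto s(2)] .
  ultimately show "\<forall>\<^sub>F \<epsilon> in at_right 0. a < s_lower \<epsilon>"
    using eventually_eps_range
    by eventually_elim (use disc_poly_sign_left(2)[OF _ _ s(1)] s in force)
next
  fix a :: real assume a: "1/2 < a"
  show "\<forall>\<^sub>F \<epsilon> in at_right 0. s_lower \<epsilon> < a"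
    using eventually_eps_range
  proof eventually_elim
    case (elim \<epsilon>)
    then show ?case using s_lower[of \<epsilon>] s_mid_bounds[of \<epsilon>] eps_hat_bounds a by auto
  qed
qed

text \<open>At \<open>eps_hat\<close> itself the cubic is negative just to the right of 1/8. By
  continuity in \<epsilon> this persists at a fixed such point shortly before
  \<open>eps_hat\<close>, which puts \<open>s_lower \<epsilon>\<close> to its left.\<close>

lemma s_lower_tendsto_eighth: "(s_lower \<longlongrightarrow> 1/8) (at_left eps_hat)"
proof -
  have range: "\<forall>\<^sub>F \<epsilon> in at_left eps_hat. 0 < \<epsilon> \<and> \<epsilon> < eps_hat"
    using eps_hat_bounds by (auto simp: eventually_at_left_field)
  have mid: "(s_mid \<longlongrightarrow> s_mid eps_hat) (at_left eps_hat)"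
    using eps_hat_bounds unfolding s_mid_def by (auto intro!: tendsto_eq_intros)
  show ?thesis
  proof (rule order_tendstoI)
    fix a :: real assume "a < 1/8"
    show "\<forall>\<^sub>F \<epsilon> in at_left eps_hat. a < s_lower \<epsilon>"
      using range by eventually_elim (use s_lower \<open>a < 1/8\<close> in force)
  next
    fix a :: real assume "1/8 < a"
    obtain s where s: "1/8 < s" "s < a" "s < s_mid eps_hat"
      using dense[of "1/8" "min a (s_mid eps_hat)"] \<open>1/8 < a\<close> s_mid_bounds[of eps_hat] eps_hat_bounds
      by auto
    have "disc_poly eps_hat s < 0"
      using s eps_hat_bounds by (intro disc_poly_neg_left) auto
    then have "\<forall>\<^sub>F \<epsilon> in at_left eps_hat. disc_poly \<epsilon> s < 0"
      by (rule order_tendstoD(2)[OF disc_poly_tendsto])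
    moreover have "\<forall>\<^sub>F \<epsilon> in at_left eps_hat. s < s_mid \<epsilon>"
      by (rule order_tendstoD(1)[OF mid s(3)])
    ultimately show "\<forall>\<^sub>F \<epsilon> in at_left eps_hat. s_lower \<epsilon> < a"
      using range
    proof eventually_elim
      case (elim \<epsilon>)
      then show ?case using disc_poly_sign_left(1)[of \<epsilon> s] s by auto
    qed
  qed
qed

section \<open>The parameter along the rest points\<close>

text \<open>The rest point equation for \<open>s = v\<^sup>2\<close> is
  \<open>16 * q * (s * (1 + s)) = (4 * s + 1)\<^sup>2\<close>, here solved for
  \<open>q\<close>.\<close>

definition q_of :: "real \<Rightarrow> real" where "q_of s = (4 * s + 1)\<^sup>2 / (16 * (s * (1 + s)))"

definition s_of :: "real \<Rightarrow> real" where "s_of q = (v_plus q)\<^sup>2"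

lemma s_of:
  assumes "3/4 < q" "q < 1"
  shows "1/8 < s_of q" "s_of q < 1/2" "q_of (s_of q) = q"
    and "s_of q = ((2 * q - 1) - sqrt (q * (4 * q - 3))) / (4 * (1 - q))"
proof -
  define R where "R = sqrt (q * (4 * q - 3))"
  have R2: "R\<^sup>2 = q * (4 * q - 3)" and R0: "R > 0" using assms by (simp_all add: R_def)
  define s where "s = ((2 * q - 1) - R) / (4 * (1 - q))"
  have "R\<^sup>2 < (2 * q - 1)\<^sup>2" unfolding R2 using assms by (simp add: power2_eq_square algebra_simps)
  then have "R < 2 * q - 1" using assms by (intro power2_less_imp_less[of R]) auto
  then have s0: "s > 0" using assms by (simp add: s_def)
  then show eq: "s_of q = ((2 * q - 1) - sqrt (q * (4 * q - 3))) / (4 * (1 - q))"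
    by (simp add: s_of_def v_plus_def s_def R_def)
  have ss: "s_of q = s" unfolding eq s_def R_def ..
  have e1: "4 * (1 - q) * s = 2 * q - 1 - R" using assms by (simp add: s_def)
  \<comment> \<open>Isolating \<open>R\<close> and squaring gives the rest point equation up to the
    factor \<open>1 - q\<close>.\<close>
  have "(1 - q) * (16 * (1 - q) * s\<^sup>2 + (8 - 16 * q) * s + 1) = 0" using e1 R2 by algebra
  then have e2: "16 * (1 - q) * s\<^sup>2 + (8 - 16 * q) * s + 1 = 0" using assms by auto
  then have "16 * q * (s * (1 + s)) = (4 * s + 1)\<^sup>2" by (simp add: power2_eq_square algebra_simps)
  then show "q_of (s_of q) = q" unfolding ss q_of_def using s0 by (subst nonzero_divide_eq_eq) (auto simp: mult_ac)
  \<comment> \<open>In terms of \<open>R\<close> the two bounds on \<open>s\<close> read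
    \<open>R < (5 * q - 3) / 2\<close> and \<open>4 * q - 3 < R\<close>; both are checked on
    squares.\<close>
  show "1/8 < s_of q"
  proof -
    have "R\<^sup>2 < ((5 * q - 3) / 2)\<^sup>2"
    proof -
      have "((5 * q - 3) / 2)\<^sup>2 - R\<^sup>2 = 9 * (1 - q)\<^sup>2 / 4"
        unfolding R2 by (simp add: power2_eq_square field_simps)
      also have "\<dots> > 0" using assms by simp
      finally show ?thesis by simp
    qed
    then have "R < (5 * q - 3) / 2" using assms by (intro power2_less_imp_less[of R]) auto
    then show ?thesis unfolding ss s_def using assms by (simp add: field_simps)
  qed
  show "s_of q < 1/2"
  proof -
    have "(4 * q - 3)\<^sup>2 < R\<^sup>2" unfolding R2 using assms
      by (simp add: power2_eq_square)
    then have "4 * q - 3 < R" using R0 by (intro power2_less_imp_less[of "4 * q - 3" R]) simp_all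
    then show ?thesis unfolding ss s_def using assms by (simp add: field_simps)
  qed
qed

text \<open>The cross-multiplied difference is \<open>(t - s) * (1 + s + t - 8 * s * t)\<close>, the
  last factor being rewritten as a visibly positive sum. It vanishes at \<open>s = t = 1/2\<close>,
  where the monotonicity ends.\<close>

lemma q_of_strict_antimono:
  assumes "0 < s" "s < t" "t \<le> 1/2"
  shows "q_of t < q_of s"
proof -
  have "(1 - 2 * t) * (1 + s) + 3 * t * (1 - 2 * s) > 0"
    using assms by (intro add_nonneg_pos) auto
  then have "(t - s) * ((1 - 2 * t) * (1 + s) + 3 * t * (1 - 2 * s)) > 0"
    using assms by simp
  then have "(4 * t + 1)\<^sup>2 * (s * (1 + s)) < (4 * s + 1)\<^sup>2 * (t * (1 + t))"
    by (simp add: power2_eq_square algebra_simps)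
  moreover have "a / (16 * k) < b / (16 * l)" if "a * l < b * k" "0 < k" "0 < l" for a b k l :: real
    using that by (simp add: divide_simps mult_ac)
  ultimately show ?thesis unfolding q_of_def using assms by simp
qed

lemma q_of_less_iff:
  assumes "0 < s" "s \<le> 1/2" "0 < t" "t \<le> 1/2"
  shows "q_of t < q_of s \<longleftrightarrow> s < t"
  using q_of_strict_antimono[of s t] q_of_strict_antimono[of t s] assms
  by (cases s t rule: linorder_cases) auto

lemma q_of_bounds:
  assumes "1/8 < s" "s < 1/2"
  shows "q_of s \<in> {3/4<..<1}"
proof -
  have "q_of (1/2) = 3/4" "q_of (1/8) = 1" by (simp_all add: q_of_def power2_eq_square)
  then show ?thesis
    using q_of_strict_antimono[of s "1/2"] q_of_strict_antimono[of "1/8" s] assms by simp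
qed

lemma q_of_tendsto:
  assumes "(f \<longlongrightarrow> s) X" "0 < s"
  shows "((\<lambda>x. q_of (f x)) \<longlongrightarrow> q_of s) X"
  unfolding q_of_def using assms by (intro tendsto_intros) auto

lemma continuous_on_s_of: "continuous_on {3/4<..<1} s_of"
proof -
  have "continuous_on {3/4<..<1::real} (\<lambda>q. ((2 * q - 1) - sqrt (q * (4 * q - 3))) / (4 * (1 - q)))"
    by (intro continuous_intros) auto
  then show ?thesis by (rule continuous_on_eq) (simp add: s_of(4))
qed

section \<open>Linearization at the rest point\<close>

text \<open>\<open>u\<close> and \<open>v\<close> enter \<open>F\<close> only through quadratic
  products, so only even powers of \<open>theta\<close> occur, and
  \<open>theta\<^sup>2 = 1/d\<close> makes \<open>F\<close> rational in \<psi>, ready for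
  differentiation.\<close>

lemma F_rational:
  assumes "\<psi> \<in> Psi"
  defines "d \<equiv> (\<psi> $ 1)\<^sup>2 - (\<psi> $ 2)\<^sup>2"
  shows "F \<psi> q = vector [- 4/3 * (\<psi> $ 1 * \<psi> $ 2 / d^3) + q powr (-1/2),
             4/3 * ((\<psi> $ 2)\<^sup>2 / d^3) + 1 / (3 * d\<^sup>2) - 1]"
proof -
  have "\<bar>\<psi> $ 2\<bar>\<^sup>2 < (\<psi> $ 1)\<^sup>2"
    using assms(1) by (intro power_strict_mono) (auto simp: Psi_def)
  then have d: "d > 0" by (simp add: d_def)
  have "(theta \<psi>)\<^sup>2 = d powr (-1/2) * d powr (-1/2)"
    unfolding theta_def d_def power2_eq_square ..
  also have "\<dots> = 1 / d"
    using d by (simp add: powr_minus_divide flip: powr_add)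
  finally have t2: "(theta \<psi>)\<^sup>2 = 1 / d" .
  have t4: "theta \<psi> ^ 4 = 1 / d\<^sup>2" and t6: "theta \<psi> ^ 6 = 1 / d^3"
    using arg_cong[OF t2, of "\<lambda>x. x^2"] arg_cong[OF t2, of "\<lambda>x. x^3"] by (simp_all add: power_divide)
  have "theta \<psi> ^ 4 * vel_v \<psi> * vel_u \<psi> = theta \<psi> ^ 6 * (\<psi> $ 1 * \<psi> $ 2)"
    "theta \<psi> ^ 4 * (vel_v \<psi>)\<^sup>2 = theta \<psi> ^ 6 * (\<psi> $ 2)\<^sup>2"
    unfolding vel_v_def vel_u_def by algebra+
  moreover have "theta \<psi> ^ 4 * (4/3 * (vel_v \<psi>)\<^sup>2 + 1/3) = 4/3 * (theta \<psi> ^ 4 * (vel_v \<psi>)\<^sup>2) + 1/3 * theta \<psi> ^ 4"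
    by (simp add: algebra_simps)
  moreover have "- 4/3 * theta \<psi> ^ 4 * vel_v \<psi> * vel_u \<psi> = - 4/3 * (theta \<psi> ^ 4 * vel_v \<psi> * vel_u \<psi>)"
    by simp
  ultimately show ?thesis
    unfolding F_def Let_def by (simp only: t4 t6) simp
qed

lemma open_Psi: "open Psi"
  unfolding Psi_def by (intro open_Collect_less continuous_intros)

lemma jacobian_F:
  assumes "\<psi> \<in> Psi"
  defines "d \<equiv> (\<psi> $ 1)\<^sup>2 - (\<psi> $ 2)\<^sup>2"
  shows "jacobian (\<lambda>\<psi>. F \<psi> q) (at \<psi>) = (4/3 / d^4) *\<^sub>R
    vector [vector [\<psi> $ 2 * (6 * (\<psi> $ 1)\<^sup>2 - d), - (\<psi> $ 1 * (d + 6 * (\<psi> $ 2)\<^sup>2))],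
            vector [- (\<psi> $ 1 * (d + 6 * (\<psi> $ 2)\<^sup>2)), \<psi> $ 2 * (3 * d + 6 * (\<psi> $ 2)\<^sup>2)]]"
    (is "_ = ?J")
proof -
  have "\<bar>\<psi> $ 2\<bar>\<^sup>2 < (\<psi> $ 1)\<^sup>2"
    using assms(1) by (intro power_strict_mono) (auto simp: Psi_def)
  then have d: "d > 0" by (simp add: d_def)
  define D where "D = (\<lambda>\<psi> :: real^2. (\<psi> $ 1)\<^sup>2 - (\<psi> $ 2)\<^sup>2)"
  define G where "G = (\<lambda>\<psi> :: real^2. vector
     [- 4/3 * (\<psi> $ 1 * \<psi> $ 2 * (1 / D \<psi> ^ 3)) + q powr (-1/2),
      4/3 * ((\<psi> $ 2)\<^sup>2 * (1 / D \<psi> ^ 3)) + 1/3 * (1 / (D \<psi>)\<^sup>2) - 1] :: real^2)"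
  have nth: "((\<lambda>x::real^2. x $ i) has_derivative (\<lambda>h. h $ i)) (at \<psi>)" for i
    by (rule bounded_linear_imp_has_derivative) (rule bounded_linear_vec_nth)
  define D' where "D' = (\<lambda>h::real^2. 2 * \<psi> $ 1 * h $ 1 - 2 * \<psi> $ 2 * h $ 2)"
  have D': "(D has_derivative D') (at \<psi>)"
    unfolding D_def D'_def by (auto intro!: derivative_eq_intros nth)
  have Dd: "D \<psi> = d" by (simp add: D_def d_def)
  \<comment> \<open>With \<open>e\<close> as a common factor, the derivatives below have polynomial
    coefficients.\<close>
  define e where "e = 1 / d^4"
  have val2: "1 / (D \<psi>)\<^sup>2 = d\<^sup>2 * e" and val3: "1 / D \<psi> ^ 3 = d * e"
    using d by (simp_all add: Dd e_def field_simps eval_nat_numeral)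
  have inv2: "((\<lambda>\<psi>. 1 / (D \<psi>)\<^sup>2) has_derivative (\<lambda>h. D' h * (- 2 * d * e))) (at \<psi>)"
    by (rule DERIV_compose_FDERIV[OF _ D'])
      (use d in \<open>auto simp: Dd e_def field_simps eval_nat_numeral intro!: derivative_eq_intros\<close>)
  have inv3: "((\<lambda>\<psi>. 1 / D \<psi> ^ 3) has_derivative (\<lambda>h. D' h * (- 3 * e))) (at \<psi>)"
    by (rule DERIV_compose_FDERIV[OF _ D'])
      (use d in \<open>auto simp: Dd e_def field_simps eval_nat_numeral intro!: derivative_eq_intros\<close>)
  have scale: "4/3 / d^4 = 4/3 * e" by (simp add: e_def)
  have 1: "((\<lambda>x. G x $ 1) has_derivative (\<lambda>h. (?J *v h) $ 1)) (at \<psi>)"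
  proof -
    have "((\<lambda>x. G x $ 1) has_derivative (\<lambda>h. - 4/3 * (\<psi> $ 1 * \<psi> $ 2 * (D' h * (- 3 * e))
        + (\<psi> $ 1 * h $ 2 + h $ 1 * \<psi> $ 2) * (1 / D \<psi> ^ 3)))) (at \<psi>)"
      unfolding G_def vector_2
      by (rule has_derivative_eq_rhs,
        (rule has_derivative_add has_derivative_mult has_derivative_const nth inv3)+) simp
    then show ?thesis
      unfolding scale by (rule has_derivative_eq_rhs)
        (simp add: fun_eq_iff matrix_vector_mult_def sum_2 val3 D'_def d_def power2_eq_square field_simps)
  qed
  have 2: "((\<lambda>x. G x $ 2) has_derivative (\<lambda>h. (?J *v h) $ 2)) (at \<psi>)"
  proof -
    have "((\<lambda>x. G x $ 2) has_derivative (\<lambda>h. 4/3 * ((\<psi> $ 2)\<^sup>2 * (D' h * (- 3 * e))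
        + 2 * \<psi> $ 2 * h $ 2 * (1 / D \<psi> ^ 3)) + 1/3 * (D' h * (- 2 * d * e)))) (at \<psi>)"
      unfolding G_def vector_2
      by (rule has_derivative_eq_rhs,
        (rule has_derivative_add has_derivative_diff has_derivative_mult has_derivative_power
          has_derivative_const nth inv2 inv3)+) (simp add: mult_ac)
    then show ?thesis
      unfolding scale by (rule has_derivative_eq_rhs)
        (simp add: fun_eq_iff matrix_vector_mult_def sum_2 val3 D'_def d_def power2_eq_square field_simps)
  qed
  have "(G has_derivative (\<lambda>h. ?J *v h)) (at \<psi>)"
    unfolding has_derivative_componentwise_within[of G]
    using 1 2 by (auto simp: Basis_vec_def inner_axis forall_2 cart_eq_inner_axis[symmetric])
  \<comment> \<open>\<open>F\<close> equals \<open>G\<close> on \<open>Psi\<close>, and since this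
    set is open the derivative carries over.\<close>
  then have "((\<lambda>\<psi>. F \<psi> q) has_derivative (\<lambda>h. ?J *v h)) (at \<psi>)"
    by (rule has_derivative_transform_within_open[OF _ open_Psi assms(1)])
      (simp add: G_def F_rational D_def)
  then have "frechet_derivative (\<lambda>\<psi>. F \<psi> q) (at \<psi>) = (\<lambda>h. ?J *v h)"
    by (rule frechet_derivative_at[symmetric])
  then show ?thesis by (simp add: jacobian_def)
qed

text \<open>The vector \<open>(u, v)\<close> lies on the unit hyperbola, so scaling it by
  \<open>r\<close> gives \<open>theta = 1/r\<close>, and normalization returns it.\<close>

lemma psi_plus_coordinates:
  assumes "3/4 < q" "q < 1"
  obtains r u where "r > 0" "u\<^sup>2 = 1 + s_of q" "psi_plus q $ 1 = r * u" "psi_plus q $ 2 = r * v_plus q"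
    "vel_u (psi_plus q) = u" "vel_v (psi_plus q) = v_plus q"
proof -
  define s where "s = s_of q"
  have s0: "s > 0" and v2: "(v_plus q)\<^sup>2 = s" using s_of(1)[OF assms] by (simp_all add: s_def flip: s_of_def)
  define r where "r = (4/3 * s + 1/3) powr (1/4)"
  define u where "u = sqrt (1 + s)"
  have r0: "r > 0" using s0 by (simp add: r_def)
  have u2: "u\<^sup>2 = 1 + s" using s0 by (simp add: u_def)
  have p: "psi_plus q $ 1 = r * u" "psi_plus q $ 2 = r * v_plus q"
    by (simp_all add: psi_plus_def Let_def v2 r_def u_def)
  have "(r * u)\<^sup>2 - (r * v_plus q)\<^sup>2 = r\<^sup>2" unfolding power_mult_distrib u2 v2 by (simp add: algebra_simps)
  then have "theta (psi_plus q) = 1 / r" using r0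
    by (simp add: theta_def p powr_minus powr_half_sqrt field_simps)
  then have "vel_u (psi_plus q) = u" "vel_v (psi_plus q) = v_plus q"
    using r0 by (simp_all add: vel_u_def vel_v_def p)
  then show thesis using that r0 u2 p by (simp add: s_def)
qed

text \<open>\<open>a\<close>, \<open>b\<close>, \<open>c\<close> are the negated coefficients of
  \<open>det (M - \<mu> B)\<close>, with \<open>B\<close> and \<open>M\<close> the two matrices at
  the rest point.\<close>

lemma linearization_eigenvalues:
  assumes "0 < \<epsilon>" "\<epsilon> \<le> 1" "3/4 < q" "q < 1"
  obtains a b c m where "a > 0" "b > 0" "c > 0" "m > 0"
    "b\<^sup>2 - 4 * a * c = m * disc_poly \<epsilon> (s_of q)"
    "eigenvalues (linearization \<epsilon> q) =
      {\<mu>. complex_of_real a * \<mu>\<^sup>2 + complex_of_real b * \<mu> + complex_of_real c = 0}"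
proof -
  define s where "s = s_of q"
  define v where "v = v_plus q"
  have s: "1/8 < s" "s < 1/2" using s_of[OF assms(3,4)] by (simp_all add: s_def)
  have v2: "v\<^sup>2 = s" by (simp add: v_def s_def s_of_def)
  have v0: "v > 0" and Psi: "psi_plus q \<in> Psi"
    using psi_plus_rest_point[OF assms(3,4)] by (simp_all add: v_def)
  obtain r u where r: "r > 0" and u2: "u\<^sup>2 = 1 + s"
    and p: "psi_plus q $ 1 = r * u" "psi_plus q $ 2 = r * v"
    and vel: "vel_u (psi_plus q) = u" "vel_v (psi_plus q) = v"
    using psi_plus_coordinates[OF assms(3,4)] unfolding s_def v_def by metis
  have r2: "(r * u)\<^sup>2 - (r * v)\<^sup>2 = r\<^sup>2" unfolding power_mult_distrib u2 v2 by (simp add: algebra_simps)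
  define k where "k = 9 * \<epsilon> / (4 - \<epsilon>)"
  have k0: "k > 0" using assms by (simp add: k_def)
  have k: "k * (4 - \<epsilon>) = 9 * \<epsilon>" using assms by (simp add: k_def)
  define B where "B = B_sharp (psi_plus q) \<epsilon>"
  define M where "M = jacobian (\<lambda>\<psi>. F \<psi> q) (at (psi_plus q))"
  \<comment> \<open>The Jacobian is \<open>4/3 / r^8\<close> times a matrix of cubics in \<psi>,
    which scale like \<open>r^3\<close>.\<close>
  define g where "g = 4/3 / r^5"
  have g0: "g > 0" using r by (simp add: g_def)
  define w where "w = 4 * (4 * s + 1) + 2 * k * (1 + 2 * s) - \<epsilon> * (1 + s)"
  have u4: "u^4 = (1 + s)\<^sup>2" and u3: "u^3 = u * (1 + s)"
    using u2 by algebra+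
  have B: "B$1$1 = (\<epsilon> - 16) * (s * (1 + s)) - k * (1 + 2 * s)\<^sup>2"
      "B$1$2 = u * v * w" "B$2$1 = u * v * w"
      "B$2$2 = \<epsilon> * (1 + s)\<^sup>2 - (4 * s + 1)\<^sup>2 - 4 * k * (s * (1 + s))"
    unfolding B_def B_sharp_def B_visc_def B_1_def B_2_def Let_def vel k_def[symmetric]
      u2 v2 u3 u4 w_def
    by (simp_all add: algebra_simps)
  define h where "h = 4/3 / (r\<^sup>2)^4"
  have sc: "h * r^3 = g" using r by (simp add: g_def h_def field_simps flip: power_mult power_add)
  have M: "M$1$1 = g * (v * (5 + 6 * s))" "M$1$2 = - (g * (u * (1 + 6 * s)))"
      "M$2$1 = - (g * (u * (1 + 6 * s)))" "M$2$2 = g * (v * (3 + 6 * s))"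
    unfolding M_def jacobian_F[OF Psi] p r2
    unfolding h_def[symmetric] sc[symmetric] power_mult_distrib u2 v2
    by (simp_all add: algebra_simps power2_eq_square power3_eq_cube)
  have uv: "u * v * (u * v) = s * (1 + s)" using u2 v2 by algebra
  define a where "a = k * (8 * s - 1 + \<epsilon> * (1 + s))"
  define b where "b = g * v * (3 * \<epsilon> * (1 + s) + (3 + k) * (1 - 2 * s))"
  define c where "c = g\<^sup>2 * (1 - 2 * s)"
  \<comment> \<open>The three constituents of \<open>B\<close> have rank one, so only their mixed
    terms reach the determinant. The relation \<open>k * (4 - \<epsilon>) = 9 * \<epsilon>\<close>
    is exactly what cancels the \<open>s\<^sup>2\<close> terms.\<close>
  have detB: "det B = - a"
  proof -
    have "det B = ((\<epsilon> - 16) * (s * (1 + s)) - k * (1 + 2 * s)\<^sup>2)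
        * (\<epsilon> * (1 + s)\<^sup>2 - (4 * s + 1)\<^sup>2 - 4 * k * (s * (1 + s))) - s * (1 + s) * w\<^sup>2"
      unfolding det_2 B using uv by algebra
    also have "\<dots> = - (9 * \<epsilon>) * (s * (1 + s)) + 9 * k * s\<^sup>2 + k * (1 - \<epsilon>) * (1 + s)\<^sup>2 - 6 * k * (s * (1 + s))"
      unfolding w_def by (simp add: algebra_simps power2_eq_square)
    also have "\<dots> = - a" unfolding a_def k[symmetric] by (simp add: algebra_simps power2_eq_square)
    finally show ?thesis .
  qed
  have detM: "det M = - c"
    unfolding det_2 M c_def using u2 v2 by algebra
  have tr: "B$2$2 * M$1$1 - B$1$2 * M$2$1 + B$1$1 * M$2$2 - B$2$1 * M$1$2 = b"
    unfolding B M b_def w_def using u2 by algebra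
  \<comment> \<open>The range of \<open>s\<close> enters here: \<open>8 * s > 1\<close> for
    \<open>a\<close>, \<open>2 * s < 1\<close> for \<open>b\<close> and \<open>c\<close>.\<close>
  have a0: "a > 0" unfolding a_def using s assms k0 by (intro mult_pos_pos add_pos_pos) auto
  have b0: "b > 0" unfolding b_def using s assms k0 g0 v0 by (intro mult_pos_pos add_pos_pos) auto
  have c0: "c > 0" unfolding c_def using s g0 by simp
  have eq: "complex_of_real (det B) * \<mu>\<^sup>2 - complex_of_real b * \<mu> + complex_of_real (det M)
      = - (complex_of_real a * \<mu>\<^sup>2 + complex_of_real b * \<mu> + complex_of_real c)" for \<mu>
    unfolding detB detM by simp
  have "det B \<noteq> 0" using detB a0 by simp
  from eigenvalues_matrix_inv_mult[OF this, of M]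
  have eig: "eigenvalues (linearization \<epsilon> q) =
      {\<mu>. complex_of_real a * \<mu>\<^sup>2 + complex_of_real b * \<mu> + complex_of_real c = 0}"
    unfolding linearization_def B_def[symmetric] M_def[symmetric] tr eq neg_equal_0_iff_equal .
  \<comment> \<open>With \<open>z\<close> in place of the quotient, \<open>b\<^sup>2\<close> and
    \<open>4 * a * c\<close> share the factor \<open>9 * g\<^sup>2 * z\<^sup>2\<close>; the leading
    \<open>s\<close> of \<open>disc_poly\<close> is the \<open>v\<^sup>2\<close> in
    \<open>b\<^sup>2\<close>.\<close>
  define z where "z = 1 / (4 - \<epsilon>)"
  have z: "z * (4 - \<epsilon>) = 1" "k = 9 * \<epsilon> * z" using assms by (simp_all add: z_def k_def)
  have z0: "z > 0" using assms by (simp add: z_def)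
  have "3 * \<epsilon> * (1 + s) + (3 + k) * (1 - 2 * s) = 3 * z * ((4 + 6 * \<epsilon> - \<epsilon>\<^sup>2) - (8 + \<epsilon>\<^sup>2) * s)"
    using z by algebra
  then have b': "b = g * v * (3 * z * ((4 + 6 * \<epsilon> - \<epsilon>\<^sup>2) - (8 + \<epsilon>\<^sup>2) * s))" by (simp add: b_def)
  have a': "a = 9 * z\<^sup>2 * (\<epsilon> * (4 - \<epsilon>) * ((8 + \<epsilon>) * s - (1 - \<epsilon>)))"
    unfolding a_def using z by algebra
  have disc: "b\<^sup>2 - 4 * a * c = (9 * g\<^sup>2 * z\<^sup>2) * disc_poly \<epsilon> s"
    unfolding a' b' c_def disc_poly_def v2[symmetric] by algebra
  show thesis
    by (rule that[OF a0 b0 c0 _ disc[unfolded s_def] eig]) (use g0 z0 in simp)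
qed

text \<open>A vanishing discriminant leaves one double real eigenvalue, hence \<open>\<ge>\<close>
  in one node criterion and \<open>>\<close> in the other.\<close>

lemma
  assumes "0 < \<epsilon>" "\<epsilon> \<le> 1" "3/4 < q" "q < 1"
  shows stable_focus_iff: "stable_focus \<epsilon> q \<longleftrightarrow> disc_poly \<epsilon> (s_of q) < 0"
    and stable_node_iff: "stable_node \<epsilon> q \<longleftrightarrow> disc_poly \<epsilon> (s_of q) \<ge> 0"
    and nondegenerate_node_iff: "nondegenerate_node \<epsilon> q \<longleftrightarrow> disc_poly \<epsilon> (s_of q) > 0"
proof -
  obtain a b c m where pos: "a > 0" "b > 0" "c > 0" "m > 0"
    and disc: "b\<^sup>2 - 4 * a * c = m * disc_poly \<epsilon> (s_of q)"
    and eig: "eigenvalues (linearization \<epsilon> q) =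
      {\<mu>. complex_of_real a * \<mu>\<^sup>2 + complex_of_real b * \<mu> + complex_of_real c = 0}"
    by (rule linearization_eigenvalues[OF assms])
  have sign: "b\<^sup>2 - 4 * a * c < 0 \<longleftrightarrow> disc_poly \<epsilon> (s_of q) < 0"
    "b\<^sup>2 - 4 * a * c \<ge> 0 \<longleftrightarrow> disc_poly \<epsilon> (s_of q) \<ge> 0"
    "b\<^sup>2 - 4 * a * c > 0 \<longleftrightarrow> disc_poly \<epsilon> (s_of q) > 0"
    unfolding disc using \<open>m > 0\<close>
    by (simp_all add: mult_less_0_iff zero_le_mult_iff zero_less_mult_iff)
  note roots = real_quadratic_complex_roots[OF pos(1-3), folded eig, unfolded sign]
  have attractor: "attractor \<epsilon> q" using roots(1) by (simp add: attractor_def)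
  show "stable_focus \<epsilon> q \<longleftrightarrow> disc_poly \<epsilon> (s_of q) < 0"
    using roots(2) attractor by (simp add: stable_focus_def)
  show node: "stable_node \<epsilon> q \<longleftrightarrow> disc_poly \<epsilon> (s_of q) \<ge> 0"
    using roots(2) attractor by (simp add: stable_node_def not_less)
  show "nondegenerate_node \<epsilon> q \<longleftrightarrow> disc_poly \<epsilon> (s_of q) > 0"
    using roots(3) node by (auto simp: nondegenerate_node_def)
qed

section \<open>Decomposition of the parameter range\<close>

text \<open>Openness of the regions comes from sign conditions on these two functions, not from
  continuity of the boundary curves.\<close>

lemma continuous_on_disc: "continuous_on Omega (\<lambda>(\<epsilon>, q). disc_poly \<epsilon> (s_of q))"
  and continuous_on_s_mid: "continuous_on Omega (\<lambda>(\<epsilon>, q). s_of q - s_mid \<epsilon>)"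
proof -
  have s: "continuous_on Omega (\<lambda>p. s_of (snd p))"
    by (rule continuous_on_compose2[OF continuous_on_s_of])
      (auto intro!: continuous_intros simp: Omega_def)
  then show "continuous_on Omega (\<lambda>(\<epsilon>, q). disc_poly \<epsilon> (s_of q))"
    unfolding case_prod_beta by (intro continuous_on_disc_poly continuous_intros)
  show "continuous_on Omega (\<lambda>(\<epsilon>, q). s_of q - s_mid \<epsilon>)"
    unfolding case_prod_beta s_mid_def
    using s by (intro continuous_intros) (auto simp: Omega_def)
qed

text \<open>On \<open>Q1\<close> and \<open>Q2\<close> the eigenvalue is real and double, so
  \<open>stable_node\<close> holds there as well. Its equivalence is therefore stated off the
  curves, and the one for \<open>nondegenerate_node\<close> on all of \<open>Omega\<close>.\<close>

theorem theorem2: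
  shows "\<exists>(q1 :: real \<Rightarrow> real) (q2 :: real \<Rightarrow> real)
           Omega_node Omega_focus Omega_node1 Omega_node2 Q1 Q2.
     q1 \<in> {0<..1} \<rightarrow> {3/4<..<1} \<and>
     q2 \<in> {0<..<eps_hat} \<rightarrow> {3/4<..<1} \<and>
     Q1 = graph_on {0<..1} q1 \<and>
     Q2 = graph_on {0<..<eps_hat} q2 \<and>
     Omega_focus = {(\<epsilon>, q) \<in> Omega. q1 \<epsilon> < q \<and> (\<epsilon> < eps_hat \<longrightarrow> q < q2 \<epsilon>)} \<and>
     Omega_node1 = {(\<epsilon>, q) \<in> Omega. q < q1 \<epsilon>} \<and>
     Omega_node2 = {(\<epsilon>, q) \<in> Omega. \<epsilon> < eps_hat \<and> q2 \<epsilon> < q} \<and>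
     Omega_node = Omega_node1 \<union> Omega_node2 \<and>
     openin (top_of_set Omega) Omega_focus \<and>
     openin (top_of_set Omega) Omega_node1 \<and>
     openin (top_of_set Omega) Omega_node2 \<and>
     openin (top_of_set Omega) Omega_node \<and>
     Omega = Omega_node \<union> Omega_focus \<union> Q1 \<union> Q2 \<and>
     Omega_node \<inter> Omega_focus = {} \<and> Omega_node \<inter> Q1 = {} \<and> Omega_node \<inter> Q2 = {} \<and>
     Omega_focus \<inter> Q1 = {} \<and> Omega_focus \<inter> Q2 = {} \<and> Q1 \<inter> Q2 = {} \<and>
     (\<forall>(\<epsilon>, q) \<in> Omega. stable_focus \<epsilon> q \<longleftrightarrow> (\<epsilon>, q) \<in> Omega_focus) \<and>
     (\<forall>(\<epsilon>, q) \<in> Omega - (Q1 \<union> Q2). stable_node \<epsilon> q \<longleftrightarrow> (\<epsilon>, q) \<in> Omega_node) \<and>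
     (\<forall>(\<epsilon>, q) \<in> Omega. nondegenerate_node \<epsilon> q \<longleftrightarrow> (\<epsilon>, q) \<in> Omega_node) \<and>
     q1 1 = 49/64 \<and>
     (q2 \<longlongrightarrow> 1) (at_left eps_hat) \<and>
     (q1 \<longlongrightarrow> 3/4) (at_right 0) \<and>
     (q2 \<longlongrightarrow> 3/4) (at_right 0)"
proof -
  \<comment> \<open>\<open>q_of\<close> reverses the order, so the upper zero yields the lower
    separatrix.\<close>
  define q1 where "q1 = (\<lambda>\<epsilon>. q_of (s_upper \<epsilon>))"
  define q2 where "q2 = (\<lambda>\<epsilon>. q_of (s_lower \<epsilon>))"
  define focus where "focus = {(\<epsilon>, q) \<in> Omega. q1 \<epsilon> < q \<and> (\<epsilon> < eps_hat \<longrightarrow> q < q2 \<epsilon>)}"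
  define node1 where "node1 = {(\<epsilon>, q) \<in> Omega. q < q1 \<epsilon>}"
  define node2 where "node2 = {(\<epsilon>, q) \<in> Omega. \<epsilon> < eps_hat \<and> q2 \<epsilon> < q}"
  note defs = focus_def node1_def node2_def
  have hat: "0 < eps_hat" "eps_hat < 1" by (rule eps_hat_bounds)+
  have lower: "1/8 < s_lower \<epsilon>" "s_lower \<epsilon> < s_mid \<epsilon>" "s_mid \<epsilon> < s_upper \<epsilon>" "s_lower \<epsilon> < 1/2"
    if "0 < \<epsilon>" "\<epsilon> < eps_hat" for \<epsilon>
    using s_lower[OF that] s_upper[of \<epsilon>] that hat by auto
  have upper: "1/8 < s_upper \<epsilon>" "s_mid \<epsilon> < s_upper \<epsilon>" "s_upper \<epsilon> < 1/2" if "0 < \<epsilon>" "\<epsilon> \<le> 1" for \<epsilon>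
    using s_upper[OF that] s_mid_bounds[OF that] by auto
  have q1_range: "q1 \<epsilon> \<in> {3/4<..<1}" if "0 < \<epsilon>" "\<epsilon> \<le> 1" for \<epsilon>
    unfolding q1_def using upper[OF that] by (intro q_of_bounds)
  have q2_range: "q2 \<epsilon> \<in> {3/4<..<1}" if "0 < \<epsilon>" "\<epsilon> < eps_hat" for \<epsilon>
    unfolding q2_def using lower[OF that] by (intro q_of_bounds)
  have q1_q2: "q1 \<epsilon> < q2 \<epsilon>" if "0 < \<epsilon>" "\<epsilon> < eps_hat" for \<epsilon>
    unfolding q1_def q2_def using lower[OF that] upper[of \<epsilon>] that hat
    by (intro q_of_strict_antimono) auto
  have less_q1: "q < q1 \<epsilon> \<longleftrightarrow> s_upper \<epsilon> < s_of q" and q1_less: "q1 \<epsilon> < q \<longleftrightarrow> s_of q < s_upper \<epsilon>"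
    if "(\<epsilon>, q) \<in> Omega" for \<epsilon> q
    using that upper[of \<epsilon>] s_of(1-3)[of q] q_of_less_iff[of "s_upper \<epsilon>" "s_of q"]
      q_of_less_iff[of "s_of q" "s_upper \<epsilon>"]
    by (auto simp: Omega_def q1_def)
  have q2_less: "q2 \<epsilon> < q \<longleftrightarrow> s_of q < s_lower \<epsilon>" and less_q2: "q < q2 \<epsilon> \<longleftrightarrow> s_lower \<epsilon> < s_of q"
    if "(\<epsilon>, q) \<in> Omega" "\<epsilon> < eps_hat" for \<epsilon> q
    using that lower[of \<epsilon>] s_of(1-3)[of q] q_of_less_iff[of "s_lower \<epsilon>" "s_of q"]
      q_of_less_iff[of "s_of q" "s_lower \<epsilon>"]
    by (auto simp: Omega_def q2_def)
  have neg: "disc_poly \<epsilon> (s_of q) < 0 \<longleftrightarrow> (\<epsilon>, q) \<in> focus"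
    and pos: "disc_poly \<epsilon> (s_of q) > 0 \<longleftrightarrow> (\<epsilon>, q) \<in> node1 \<union> node2"
    if "(\<epsilon>, q) \<in> Omega" for \<epsilon> q
    using that disc_poly_neg_iff[of \<epsilon> "s_of q"] disc_poly_pos_iff[of \<epsilon> "s_of q"] s_of(1)[of q]
      less_q1[OF that] q1_less[OF that] q2_less[OF that] less_q2[OF that]
    by (auto simp: Omega_def defs)
  \<comment> \<open>\<open>s_mid \<epsilon>\<close> separates the two zeros, so its position
    relative to \<open>s_of q\<close> tells the two node regions apart.\<close>
  have node1: "(\<epsilon>, q) \<in> node1 \<longleftrightarrow> disc_poly \<epsilon> (s_of q) > 0 \<and> s_of q - s_mid \<epsilon> > 0"
    and node2: "(\<epsilon>, q) \<in> node2 \<longleftrightarrow> disc_poly \<epsilon> (s_of q) > 0 \<and> s_of q - s_mid \<epsilon> < 0"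
    if "(\<epsilon>, q) \<in> Omega" for \<epsilon> q
    using that pos[OF that] less_q1[OF that] q2_less[OF that] upper[of \<epsilon>] lower[of \<epsilon>]
    by (auto simp: Omega_def defs)
  have open_focus: "openin (top_of_set Omega) focus"
  proof -
    have "focus = Omega \<inter> (\<lambda>(\<epsilon>, q). disc_poly \<epsilon> (s_of q)) -` {..<0}"
      using neg by (auto simp: focus_def)
    then show ?thesis by (metis continuous_openin_preimage_gen[OF continuous_on_disc] open_lessThan)
  qed
  have open_node1: "openin (top_of_set Omega) node1"
  proof -
    have "node1 = (Omega \<inter> (\<lambda>(\<epsilon>, q). disc_poly \<epsilon> (s_of q)) -` {0<..})
        \<inter> (Omega \<inter> (\<lambda>(\<epsilon>, q). s_of q - s_mid \<epsilon>) -` {0<..})"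
      (is "_ = ?S")
    proof (rule set_eqI, clarify)
      fix \<epsilon> q
      show "(\<epsilon>, q) \<in> node1 \<longleftrightarrow> (\<epsilon>, q) \<in> ?S"
        using node1[of \<epsilon> q] by (cases "(\<epsilon>, q) \<in> Omega") (auto simp: node1_def)
    qed
    then show ?thesis
      by (metis continuous_openin_preimage_gen[OF continuous_on_disc]
        continuous_openin_preimage_gen[OF continuous_on_s_mid] openin_Int open_greaterThan)
  qed
  have open_node2: "openin (top_of_set Omega) node2"
  proof -
    have "node2 = (Omega \<inter> (\<lambda>(\<epsilon>, q). disc_poly \<epsilon> (s_of q)) -` {0<..})
        \<inter> (Omega \<inter> (\<lambda>(\<epsilon>, q). s_of q - s_mid \<epsilon>) -` {..<0})"
      (is "_ = ?S")
    proof (rule set_eqI, clarify)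
      fix \<epsilon> q
      show "(\<epsilon>, q) \<in> node2 \<longleftrightarrow> (\<epsilon>, q) \<in> ?S"
        using node2[of \<epsilon> q] by (cases "(\<epsilon>, q) \<in> Omega") (auto simp: node2_def)
    qed
    then show ?thesis
      by (metis continuous_openin_preimage_gen[OF continuous_on_disc]
        continuous_openin_preimage_gen[OF continuous_on_s_mid] openin_Int open_greaterThan open_lessThan)
  qed
  have graphs: "graph_on {0<..1} q1 = {(\<epsilon>, q) \<in> Omega. q = q1 \<epsilon>}"
    "graph_on {0<..<eps_hat} q2 = {(\<epsilon>, q) \<in> Omega. \<epsilon> < eps_hat \<and> q = q2 \<epsilon>}"
    using q1_range q2_range hat by (auto simp: graph_on_def Omega_def)
  have q12: "q1 \<epsilon> < q2 \<epsilon>" if "(\<epsilon>, q) \<in> Omega" "\<epsilon> < eps_hat" for \<epsilon> q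
    using that q1_q2 by (auto simp: Omega_def)
  have cover: "Omega = node1 \<union> node2 \<union> focus \<union> graph_on {0<..1} q1 \<union> graph_on {0<..<eps_hat} q2"
    unfolding graphs defs by force
  have disjoint: "(node1 \<union> node2) \<inter> focus = {}"
    "(node1 \<union> node2) \<inter> graph_on {0<..1} q1 = {}" "(node1 \<union> node2) \<inter> graph_on {0<..<eps_hat} q2 = {}"
    "focus \<inter> graph_on {0<..1} q1 = {}" "focus \<inter> graph_on {0<..<eps_hat} q2 = {}"
    "graph_on {0<..1} q1 \<inter> graph_on {0<..<eps_hat} q2 = {}"
    unfolding graphs defs using q12 by fastforce+
  have focus_iff: "\<forall>(\<epsilon>, q) \<in> Omega. stable_focus \<epsilon> q \<longleftrightarrow> (\<epsilon>, q) \<in> focus"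
    using neg stable_focus_iff by (auto simp: Omega_def)
  have nondegenerate_iff: "\<forall>(\<epsilon>, q) \<in> Omega. nondegenerate_node \<epsilon> q \<longleftrightarrow> (\<epsilon>, q) \<in> node1 \<union> node2"
    using pos nondegenerate_node_iff by (auto simp: Omega_def)
  have node_iff: "\<forall>(\<epsilon>, q) \<in> Omega - (graph_on {0<..1} q1 \<union> graph_on {0<..<eps_hat} q2).
      stable_node \<epsilon> q \<longleftrightarrow> (\<epsilon>, q) \<in> node1 \<union> node2"
  proof -
    have "stable_node \<epsilon> q \<longleftrightarrow> (\<epsilon>, q) \<in> node1 \<union> node2"
      if om: "(\<epsilon>, q) \<in> Omega"
        and off: "(\<epsilon>, q) \<notin> graph_on {0<..1} q1 \<union> graph_on {0<..<eps_hat} q2" for \<epsilon> q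
    proof -
      have "(\<epsilon>, q) \<in> node1 \<union> node2 \<or> (\<epsilon>, q) \<in> focus" using om off cover by blast
      then show ?thesis
        using om neg[OF om] pos[OF om] stable_node_iff[of \<epsilon> q] by (auto simp: Omega_def)
    qed
    then show ?thesis by blast
  qed
  have q_of_values: "q_of (1/2) = 3/4" "q_of (1/8) = 1" "q_of (1/3) = 49/64"
    by (simp_all add: q_of_def power2_eq_square)
  have at_1: "q1 1 = 49/64" by (simp add: q1_def s_upper_1 q_of_values)
  have lim: "(q2 \<longlongrightarrow> 1) (at_left eps_hat)" "(q1 \<longlongrightarrow> 3/4) (at_right 0)" "(q2 \<longlongrightarrow> 3/4) (at_right 0)"
    using q_of_tendsto[OF s_lower_tendsto_eighth] q_of_tendsto[OF s_upper_tendsto]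
      q_of_tendsto[OF s_lower_tendsto_half]
    by (simp_all add: q1_def q2_def q_of_values)
  show ?thesis
    by (rule exI[of _ q1], rule exI[of _ q2], rule exI[of _ "node1 \<union> node2"], rule exI[of _ focus],
        rule exI[of _ node1], rule exI[of _ node2], rule exI[of _ "graph_on {0<..1} q1"],
        rule exI[of _ "graph_on {0<..<eps_hat} q2"])
      (intro conjI Pi_I refl focus_def node1_def node2_def open_focus open_node1 open_node2
        openin_Un cover disjoint focus_iff node_iff nondegenerate_iff at_1 lim q1_range q2_range;
        simp)
qed

end
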